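(* For every integer $N\ge 1$ there is exactly one Markov kernel $\Lambda\in\widetilde{\mathcal{K}}_N$ such that $\widetilde D_N\Lambda=\Lambda L$ (as operators on polynomial functions), and it is trivial, i.e. the measures $\Lambda(y,\cdot)$, $y\in\{-N,\dots,0\}$, are all equal.
   Context: For an integer $N\ge 0$, the reverse Yule generator $\widetilde D_N$ acts on functions on $\{-N,-N+1,\dots,0\}$ by $\widetilde D_N[f](y)=(1-y)\,(f(y-1)-f(y))$ for $y\in\{-N+1,\dots,0\}$ and $\widetilde D_N[f](-N)=0$. The Ornstein-Uhlenbeck operator $L$ acts on the space $\mathcal{P}$ of polynomial functions on $\mathbb{R}$ by $L[f](x)=f''(x)-xf'(x)$. $\widetilde{\mathcal{K}}_N$ is the set of Markov kernels $\Lambda$ from $\{-N,\dots,0\}$ to $\mathbb{R}$ (i.e. families of Borel probability measures $\Lambda(y,\cdot)$ on $\mathbb{R}$) such that $\int\exp(x^2/4)\,\Lambda(y,dx)<\infty$ for all $y\in\{-N,\dots,0\}$. With $\Lambda[f](y)=\int f(x)\,\Lambda(y,dx)$, the relation $\widetilde D_N\Lambda=\Lambda L$ means $\widetilde D_N[\Lambda[f]]=\Lambda[L[f]]$ for all $f\in\mathcal{P}$. *)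

theory Defs
  imports "HOL-Probability.Probability"
begin

definition rev_yule :: "nat \<Rightarrow> (int \<Rightarrow> real) \<Rightarrow> int \<Rightarrow> real" where
  "rev_yule N f y =
     (if y \<in> {- int N + 1..0} then (1 - real_of_int y) * (f (y - 1) - f y) else 0)"

definition poly_funs :: "(real \<Rightarrow> real) set" where
  "poly_funs = range poly"

definition OU :: "(real \<Rightarrow> real) \<Rightarrow> real \<Rightarrow> real" where
  "OU f x = deriv (deriv f) x - x * deriv f x"

text \<open>Kernels are taken extensional on the state space, so that equality of kernels as HOL
  functions is equality of the families of measures indexed by it. As the state space is finite
  and discrete, measurability in the first argument is automatic.\<close>

definition yule_kernels :: "nat \<Rightarrow> (int \<Rightarrow> real measure) set" where
  "yule_kernels N =
     {\<Lambda> \<in> {- int N..0} \<rightarrow>\<^sub>E space (prob_algebra borel).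
        \<forall>y\<in>{- int N..0}. (\<integral>\<^sup>+ x. ennreal (exp (x\<^sup>2 / 4)) \<partial>\<Lambda> y) < \<infinity>}"

definition kernel_app :: "(int \<Rightarrow> real measure) \<Rightarrow> (real \<Rightarrow> real) \<Rightarrow> int \<Rightarrow> real" where
  "kernel_app \<Lambda> f y = (\<integral>x. f x \<partial>\<Lambda> y)"

definition intertwines :: "nat \<Rightarrow> (int \<Rightarrow> real measure) \<Rightarrow> bool" where
  "intertwines N \<Lambda> \<longleftrightarrow>
     (\<forall>f\<in>poly_funs. \<forall>y\<in>{- int N..0}.
        rev_yule N (kernel_app \<Lambda> f) y = kernel_app \<Lambda> (OU f) y)"

end

theory Submission
  imports Defs
begin

text \<open>Write the moment generating function of \<open>\<Lambda>(y,\<cdot>)\<close> as \<open>G\<^sub>y(t) exp(t\<^sup>2/2)\<close>. With \<open>n = 1 - y\<close>, the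
  intertwining relation reads \<open>t G\<^sub>y' = n (G\<^sub>y - G\<^bsub>y-1\<^esub>)\<close>, and it forces \<open>G\<^sub>y = 1\<close> at the leftmost
  state. If \<open>G\<^bsub>y-1\<^esub> = 1\<close>, then \<open>G\<^sub>y = 1 + c t\<^sup>n\<close> and, one state further,
  \<open>G\<^bsub>y+1\<^esub> = 1 + b t\<^bsup>n-1\<^esup> - (n - 1) c t\<^sup>n\<close>. Moment generating functions are positive, so comparing the
  signs as \<open>t\<close> tends to infinity yields \<open>c = 0\<close> when \<open>n \<ge> 2\<close>; for \<open>n = 1\<close> positivity of
  \<open>1 + c t\<close> on the whole line suffices. Hence \<open>G\<^sub>y = 1\<close> for all \<open>y\<close>, and the integrability of
  \<open>exp(x\<^sup>2/4)\<close> makes the characteristic function, hence the law, a function of the moments.\<close>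

subsection \<open>Moments and exponential moments\<close>

definition square_exp_law :: "real measure \<Rightarrow> bool" where
  "square_exp_law M \<longleftrightarrow>
     M \<in> space (prob_algebra borel) \<and> (\<integral>\<^sup>+ x. ennreal (exp (x\<^sup>2 / 4)) \<partial>M) < \<infinity>"

lemma square_exp_law_real_distribution:
  assumes "square_exp_law M" shows "real_distribution M"
proof -
  have "prob_space M" "sets M = sets borel"
    using assms by (auto simp: square_exp_law_def space_prob_algebra)
  then show ?thesis
    by (auto simp: real_distribution_def real_distribution_axioms_def dest: sets_eq_imp_space_eq)
qed

lemma integrable_exp_square:
  assumes "square_exp_law M" shows "integrable M (\<lambda>x. exp (x\<^sup>2 / 4))"
proof -
  interpret real_distribution M by (rule square_exp_law_real_distribution[OF assms])
  show ?thesis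
    using assms by (intro integrableI_bounded) (auto simp: square_exp_law_def)
qed

text \<open>Completing the square: the weight exp(x^2/4) absorbs every exponential of |x|, at the
  price of the constant exp(|z|^2).\<close>

lemma norm_mult_le_square: "norm (z::complex) * \<bar>x\<bar> \<le> x\<^sup>2 / 4 + (norm z)\<^sup>2"
proof -
  have "0 \<le> (\<bar>x\<bar> / 2 - norm z)\<^sup>2" by simp
  then show ?thesis by (simp add: power2_eq_square algebra_simps)
qed

lemma integrable_power:
  assumes "square_exp_law M" shows "integrable M (\<lambda>x. x ^ k)"
proof -
  interpret real_distribution M by (rule square_exp_law_real_distribution[OF assms])
  have bound: "\<bar>x\<bar> ^ k \<le> fact k * exp 1 * exp (x\<^sup>2 / 4)" for x :: real
  proof -
    have "(\<lambda>n. \<bar>x\<bar> ^ n /\<^sub>R fact n) sums exp \<bar>x\<bar>" by (rule exp_converges)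
    then have "\<bar>x\<bar> ^ k /\<^sub>R fact k \<le> exp \<bar>x\<bar>"
      using sum_le_suminf[of "\<lambda>n. \<bar>x\<bar> ^ n /\<^sub>R fact n" "{k}"] by (simp add: sums_iff)
    also have "\<dots> \<le> exp (x\<^sup>2 / 4 + 1)" using norm_mult_le_square[of 1 x] by simp
    finally have "\<bar>x\<bar> ^ k \<le> fact k * exp (x\<^sup>2 / 4 + 1)" by (simp add: field_simps)
    then show ?thesis by (simp only: exp_add mult_ac)
  qed
  show ?thesis
    by (rule Bochner_Integration.integrable_bound[where f = "\<lambda>x. fact k * exp 1 * exp (x\<^sup>2 / 4)"])
       (use integrable_exp_square[OF assms] bound in \<open>auto simp: power_abs\<close>)
qed

lemma integrable_poly:
  assumes "square_exp_law M" shows "integrable M (poly p)"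
proof -
  have "poly p = (\<lambda>x. \<Sum>i\<le>degree p. coeff p i * x ^ i)" by (rule ext) (rule poly_altdef)
  then show ?thesis using integrable_power[OF assms] by simp
qed

text \<open>The partial sums are bounded by exp(|z| |x|), hence by a multiple of the weight, so
  dominated convergence moves the sum out of the integral. Complex z covers both z = t (exponential
  moments) and z = i t (characteristic function).\<close>

lemma moment_series_sums:
  fixes z :: complex
  assumes "square_exp_law M"
  shows "(\<lambda>k. complex_of_real ((\<integral>x. x ^ k \<partial>M) / fact k) * z ^ k) sums
           (\<integral>x. exp (z * of_real x) \<partial>M)"
proof -
  interpret real_distribution M by (rule square_exp_law_real_distribution[OF assms])
  let ?t = "\<lambda>k x. (z ^ k / fact k) * complex_of_real (x ^ k)"
  have it: "integrable M (?t k)" for k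
    using integrable_power[OF assms] by (intro integrable_mult_right integrable_of_real)
  have conv: "(\<lambda>k. ?t k x) sums exp (z * of_real x)" for x :: real
    using exp_converges[of "z * of_real x"]
    by (simp add: scaleR_conv_of_real power_mult_distrib field_simps)
  have bound: "norm (\<Sum>k<n. ?t k x) \<le> exp ((norm z)\<^sup>2) * exp (x\<^sup>2 / 4)" for n and x :: real
  proof -
    have s: "(\<lambda>k. (norm z * \<bar>x\<bar>) ^ k /\<^sub>R fact k) sums exp (norm z * \<bar>x\<bar>)" by (rule exp_converges)
    have "norm (\<Sum>k<n. ?t k x) \<le> (\<Sum>k<n. (norm z * \<bar>x\<bar>) ^ k /\<^sub>R fact k)"
      by (rule sum_norm_le)
         (simp add: norm_mult norm_divide norm_power power_mult_distrib power_abs field_simps)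
    also have "\<dots> \<le> exp (norm z * \<bar>x\<bar>)"
      using s sum_le_suminf[of "\<lambda>k. (norm z * \<bar>x\<bar>) ^ k /\<^sub>R fact k" "{..<n}"]
      by (simp add: sums_iff)
    also have "\<dots> \<le> exp (x\<^sup>2 / 4 + (norm z)\<^sup>2)"
      using norm_mult_le_square[of z x] by simp
    finally show ?thesis by (simp add: exp_add mult.commute)
  qed
  have "(\<lambda>n. \<integral>x. (\<Sum>k<n. ?t k x) \<partial>M) \<longlonglongrightarrow> (\<integral>x. exp (z * of_real x) \<partial>M)"
    by (rule integral_dominated_convergence[where w = "\<lambda>x. exp ((norm z)\<^sup>2) * exp (x\<^sup>2 / 4)"])
       (use integrable_exp_square[OF assms] bound conv in \<open>auto simp: sums_def\<close>)
  moreover have "(\<integral>x. (\<Sum>k<n. ?t k x) \<partial>M) =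
      (\<Sum>k<n. complex_of_real ((\<integral>x. x ^ k \<partial>M) / fact k) * z ^ k)" for n
  proof -
    have "(\<integral>x. (\<Sum>k<n. ?t k x) \<partial>M) = (\<Sum>k<n. (\<integral>x. ?t k x \<partial>M))"
      by (rule Bochner_Integration.integral_sum) (rule it)
    also have "\<dots> = (\<Sum>k<n. (z ^ k / fact k) * complex_of_real (\<integral>x. x ^ k \<partial>M))"
      by (simp only: integral_mult_right_zero integral_complex_of_real)
    finally show ?thesis by (simp add: mult.commute)
  qed
  ultimately show ?thesis by (simp add: sums_def)
qed

lemma integrable_exp_linear:
  assumes "square_exp_law M" shows "integrable M (\<lambda>x. exp (t * x))"
proof -
  interpret real_distribution M by (rule square_exp_law_real_distribution[OF assms])
  have bound: "exp (t * x) \<le> exp (t\<^sup>2) * exp (x\<^sup>2 / 4)" for x :: real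
  proof -
    have "t * x \<le> \<bar>t\<bar> * \<bar>x\<bar>" by (metis abs_ge_self abs_mult)
    then show ?thesis
      using norm_mult_le_square[of "of_real t" x] by (simp flip: exp_add)
  qed
  show ?thesis
    by (rule Bochner_Integration.integrable_bound[where f = "\<lambda>x. exp (t\<^sup>2) * exp (x\<^sup>2 / 4)"])
       (use integrable_exp_square[OF assms] bound in auto)
qed

subsection \<open>The exponential generating function of the moments\<close>

text \<open>A formal series turns the intertwining relation into algebra on coefficients;
  convergence enters only for positivity and for uniqueness of the law.\<close>

definition mgf_fps :: "real measure \<Rightarrow> real fps" where
  "mgf_fps M = Abs_fps (\<lambda>k. (\<integral>x. x ^ k \<partial>M) / fact k)"

lemma mgf_fps_sums:
  assumes "square_exp_law M"
  shows "(\<lambda>k. fps_nth (mgf_fps M) k * t ^ k) sums (\<integral>x. exp (t * x) \<partial>M)"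
proof -
  have "(\<integral>x. exp (complex_of_real t * of_real x) \<partial>M) = complex_of_real (\<integral>x. exp (t * x) \<partial>M)"
    unfolding of_real_mult[symmetric] exp_of_real by (rule integral_complex_of_real)
  then have "(\<lambda>k. complex_of_real (fps_nth (mgf_fps M) k * t ^ k)) sums
      complex_of_real (\<integral>x. exp (t * x) \<partial>M)"
    using moment_series_sums[OF assms, of "of_real t"] by (simp add: mgf_fps_def)
  then show ?thesis by (simp only: sums_of_real_iff)
qed

lemma mgf_fps_inject:
  assumes "square_exp_law M" "square_exp_law M'" "mgf_fps M = mgf_fps M'"
  shows "M = M'"
proof (rule Levy_uniqueness)
  show "real_distribution M" "real_distribution M'"
    using assms square_exp_law_real_distribution by auto
  have "(\<integral>x. x ^ k \<partial>M) / fact k = (\<integral>x. x ^ k \<partial>M') / fact k" for k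
    using arg_cong[OF assms(3), of "\<lambda>F. fps_nth F k"] by (simp add: mgf_fps_def)
  then have "(\<integral>x. exp (\<i> * of_real t * of_real x) \<partial>M) =
      (\<integral>x. exp (\<i> * of_real t * of_real x) \<partial>M')" for t :: real
    using moment_series_sums[OF assms(1), of "\<i> * of_real t"]
      moment_series_sums[OF assms(2), of "\<i> * of_real t"] by (simp only: sums_unique2)
  then show "char M = char M'"
    by (simp add: char_def fun_eq_iff mult.assoc)
qed

lemma mgf_fps_nth_0:
  assumes "square_exp_law M" shows "fps_nth (mgf_fps M) 0 = 1"
proof -
  interpret real_distribution M by (rule square_exp_law_real_distribution[OF assms])
  show ?thesis using prob_space by (simp add: mgf_fps_def)
qed

lemma mgf_pos:
  assumes "square_exp_law M" shows "0 < (\<integral>x. exp (t * x) \<partial>M)"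
proof -
  interpret real_distribution M by (rule square_exp_law_real_distribution[OF assms])
  have "0 \<le> (\<integral>x. exp (t * x) \<partial>M)" by simp
  \<comment> \<open>A zero integral would force exp(t x) = 0 almost everywhere.\<close>
  moreover have "(\<integral>x. exp (t * x) \<partial>M) \<noteq> 0"
    using integral_nonneg_eq_0_iff_AE[OF integrable_exp_linear[OF assms, of t]]
    by (auto simp: AE_False)
  ultimately show ?thesis by linarith
qed

text \<open>Horner induction on \<open>p\<close>: multiplication by \<open>fps_X\<close> shifts the
  series by one index, and the new coefficient 0 vanishes.\<close>

lemma fps_of_poly_mult_sums:
  fixes F :: "real fps"
  assumes "(\<lambda>k. fps_nth F k * t ^ k) sums s"
  shows "(\<lambda>k. fps_nth (fps_of_poly p * F) k * t ^ k) sums (poly p t * s)"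
proof (induction p)
  case 0
  show ?case by simp
next
  case (pCons a p)
  let ?H = "fps_of_poly p * F"
  have "(\<lambda>k. t * (fps_nth ?H k * t ^ k)) sums (t * (poly p t * s))"
    by (rule sums_mult) (rule pCons.IH)
  then have "(\<lambda>k. fps_nth (fps_X * ?H) (Suc k) * t ^ Suc k) sums (t * (poly p t * s))"
    by (simp only: fps_X_mult_nth power_Suc) (simp add: mult_ac del: fps_of_poly_mult)
  then have "(\<lambda>k. fps_nth (fps_X * ?H) k * t ^ k) sums (t * (poly p t * s))"
    by (subst (asm) sums_Suc_iff) simp
  moreover have "(\<lambda>k. a * (fps_nth F k * t ^ k)) sums (a * s)"
    by (rule sums_mult) (rule assms)
  ultimately have "(\<lambda>k. a * (fps_nth F k * t ^ k) + fps_nth (fps_X * ?H) k * t ^ k) sums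
      (a * s + t * (poly p t * s))" by (intro sums_add)
  moreover have "fps_of_poly (pCons a p) * F = fps_const a * F + fps_X * ?H"
    by (simp add: fps_of_poly_pCons algebra_simps)
  ultimately show ?case by (simp add: algebra_simps)
qed

section \<open>The Ornstein-Uhlenbeck operator on moments\<close>

lemma OU_poly: "OU (poly p) = poly (pderiv (pderiv p) - [:0, 1:] * pderiv p)"
proof -
  have deriv: "deriv (poly q) = poly (pderiv q)" for q :: "real poly"
    by (rule ext) (rule DERIV_imp_deriv[OF poly_DERIV])
  show ?thesis by (rule ext) (simp add: OU_def deriv)
qed

text \<open>From L[x^k] = k (k-1) x^(k-2) - k x^k: with F the moment series, the second derivative
  contributes t^2 F and the drift -t F'.\<close>

lemma mgf_fps_OU:
  assumes "square_exp_law M"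
  shows "(\<integral>x. OU (\<lambda>x. x ^ k) x \<partial>M) / fact k =
           fps_nth (fps_X * (fps_X * mgf_fps M - fps_deriv (mgf_fps M))) k"
proof -
  note int = integrable_power[OF assms]
  \<comment> \<open>Truncated subtraction is harmless: for k < 2 the factor k (k-1) is 0.\<close>
  have OU: "OU (\<lambda>x. x ^ k) x = real k * (real (k - 1) * x ^ (k - 2)) - real k * x ^ k" for x
  proof -
    have "(\<lambda>x::real. x ^ k) = poly (monom 1 k)" by (simp add: fun_eq_iff poly_monom)
    then show ?thesis
      by (cases k) (simp_all add: OU_poly pderiv_monom poly_monom numeral_2_eq_2)
  qed
  have "(\<integral>x. OU (\<lambda>x. x ^ k) x \<partial>M) =
      real k * (real (k - 1) * (\<integral>x. x ^ (k - 2) \<partial>M)) - real k * (\<integral>x. x ^ k \<partial>M)"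
    unfolding OU using int by (subst Bochner_Integration.integral_diff) auto
  note eq = this
  consider "k = 0" | "k = 1" | j where "k = Suc (Suc j)"
    by (metis One_nat_def not0_implies_Suc)
  then show ?thesis
  proof cases
    case 3
    have "(real (Suc (Suc j)) * (real (Suc j) * a) - real (Suc (Suc j)) * b) / fact (Suc (Suc j)) =
        a / fact j - real (Suc (Suc j)) * (b / fact (Suc (Suc j)))" for a b
      by (simp add: divide_simps) (simp add: algebra_simps)
    then show ?thesis
      unfolding eq by (simp add: 3 mgf_fps_def del: of_nat_Suc power_Suc fact_Suc)
  qed (unfold eq, simp_all add: mgf_fps_def)
qed

subsection \<open>The standard Gaussian law\<close>

text \<open>The weight times the standard normal density is sqrt 2 times the centred normal density
  of variance 2.\<close>

lemma square_exp_law_std_normal: "square_exp_law std_normal_distribution"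
proof -
  have "(\<integral>\<^sup>+ x. ennreal (exp (x\<^sup>2 / 4)) \<partial>std_normal_distribution) =
      (\<integral>\<^sup>+ x. ennreal (sqrt 2 * normal_density 0 (sqrt 2) x) \<partial>lborel)"
  proof (subst nn_integral_density, simp, simp, rule nn_integral_cong)
    fix x :: real
    have "std_normal_density x * exp (x\<^sup>2 / 4) = sqrt 2 * normal_density 0 (sqrt 2) x"
      by (simp add: normal_density_def real_sqrt_mult field_simps flip: exp_add)
    then show "ennreal (std_normal_density x) * ennreal (exp (x\<^sup>2 / 4)) =
        ennreal (sqrt 2 * normal_density 0 (sqrt 2) x)"
      by (simp flip: ennreal_mult)
  qed
  also have "\<dots> = ennreal (\<integral>x. sqrt 2 * normal_density 0 (sqrt 2) x \<partial>lborel)"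
    by (rule nn_integral_eq_integral) auto
  also have "\<dots> < \<infinity>" by simp
  finally show ?thesis
    using prob_space_normal_density[of 1 0]
    by (simp add: square_exp_law_def space_prob_algebra)
qed

lemma std_normal_moment_Suc_Suc:
  "(\<integral>x. x ^ Suc (Suc k) \<partial>std_normal_distribution) =
     real (Suc k) * (\<integral>x. x ^ k \<partial>std_normal_distribution)"
proof (cases "even k")
  case True
  then obtain j where j: "k = 2 * j" by (elim evenE)
  have "(\<integral>x. x ^ (2 * Suc j) \<partial>std_normal_distribution) =
     real (Suc k) * (\<integral>x. x ^ (2 * j) \<partial>std_normal_distribution)"
    unfolding std_normal_distribution_even_moments j
    by (simp add: divide_simps)
  then show ?thesis by (simp add: j)
next
  case False
  then have "(\<integral>x. x ^ Suc (Suc k) \<partial>std_normal_distribution) = 0"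
    by (intro integral_std_normal_distribution_moment_odd) simp
  moreover have "(\<integral>x. x ^ k \<partial>std_normal_distribution) = 0"
    using False by (intro integral_std_normal_distribution_moment_odd) simp
  ultimately show ?thesis by simp
qed

text \<open>Formal version of E' = t E for E = exp(t^2/2), read off from the recursion of the
  Gaussian moments.\<close>

lemma fps_deriv_mgf_std_normal:
  "fps_deriv (mgf_fps std_normal_distribution) = fps_X * mgf_fps std_normal_distribution"
proof (rule fps_ext)
  fix k
  show "fps_nth (fps_deriv (mgf_fps std_normal_distribution)) k =
      fps_nth (fps_X * mgf_fps std_normal_distribution) k"
  proof (cases k)
    case 0
    then show ?thesis
      using integral_std_normal_distribution_moment_odd[of 1] by (simp add: mgf_fps_def)
  next
    case (Suc j)
    have "real (Suc (Suc j)) * (real (Suc j) * m / fact (Suc (Suc j))) = m / fact j" for m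
      by (simp add: divide_simps)
    then show ?thesis
      by (simp add: Suc mgf_fps_def std_normal_moment_Suc_Suc del: of_nat_Suc power_Suc fact_Suc)
  qed
qed

text \<open>Invariance of the Gaussian law: E' = t E makes the series in \<open>mgf_fps_OU\<close>
  vanish, which settles monomials; linearity does the rest.\<close>

lemma integral_OU_std_normal: "(\<integral>x. OU (poly p) x \<partial>std_normal_distribution) = 0"
proof -
  let ?\<gamma> = std_normal_distribution
  note law = square_exp_law_std_normal
  have monom: "(\<integral>x. OU (poly (monom 1 k)) x \<partial>?\<gamma>) = 0" for k
  proof -
    have "poly (monom 1 k) = (\<lambda>x::real. x ^ k)" by (simp add: fun_eq_iff poly_monom)
    then show ?thesis
      using mgf_fps_OU[OF law, of k] by (simp add: fps_deriv_mgf_std_normal)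
  qed
  have "(\<integral>x. OU (poly (smult a q + r)) x \<partial>?\<gamma>) =
      a * (\<integral>x. OU (poly q) x \<partial>?\<gamma>) + (\<integral>x. OU (poly r) x \<partial>?\<gamma>)" for a q r
  proof -
    have "OU (poly (smult a q + r)) x = a * OU (poly q) x + OU (poly r) x" for x
      by (simp add: OU_poly pderiv_add pderiv_smult algebra_simps)
    moreover have "integrable ?\<gamma> (OU (poly q))" for q
      unfolding OU_poly by (rule integrable_poly[OF law])
    ultimately show ?thesis by simp
  qed
  note lin = this
  have "(\<integral>x. OU (poly (\<Sum>i\<in>I. monom (coeff p i) i)) x \<partial>?\<gamma>) = 0" if "finite I" for I
    using that
  proof induction
    case empty
    have "OU (poly 0) x = 0" for x by (simp add: OU_poly)
    then show ?case by (simp only: sum.empty integral_zero)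
  next
    case (insert i I)
    have "(\<Sum>i\<in>insert i I. monom (coeff p i) i) =
        smult (coeff p i) (monom 1 i) + (\<Sum>i\<in>I. monom (coeff p i) i)"
      using insert.hyps by (simp add: smult_monom)
    then show ?case by (simp only: lin monom insert.IH mult_zero_right add_0_right)
  qed
  from this[of "{..degree p}"] show ?thesis by (simp add: poly_as_sum_of_monoms)
qed

subsection \<open>Hermite moments\<close>

text \<open>The coefficients are \<open>\<integral>h\<^sub>k \<partial>M / k!\<close> for the Hermite polynomials \<open>h\<^sub>k\<close>.\<close>

definition hermite_fps :: "real measure \<Rightarrow> real fps" where
  "hermite_fps M = mgf_fps M * inverse (mgf_fps std_normal_distribution)"

lemma mgf_fps_eq_hermite:
  "mgf_fps M = hermite_fps M * mgf_fps std_normal_distribution"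
proof -
  have "inverse (mgf_fps std_normal_distribution) * mgf_fps std_normal_distribution = 1"
    by (rule inverse_mult_eq_1) (simp add: mgf_fps_nth_0 square_exp_law_std_normal)
  then show ?thesis by (simp add: hermite_fps_def mult.assoc)
qed

lemma hermite_fps_eq_1:
  assumes "square_exp_law M" "hermite_fps M = 1"
  shows "M = std_normal_distribution"
  using mgf_fps_eq_hermite[of M] unfolding assms(2) mult_1_left
  by (rule mgf_fps_inject[OF assms(1) square_exp_law_std_normal])

lemma hermite_fps_nth_0: "square_exp_law M \<Longrightarrow> fps_nth (hermite_fps M) 0 = 1"
  by (simp add: hermite_fps_def mgf_fps_nth_0 square_exp_law_std_normal)

text \<open>The formal factorisation can be evaluated at every real t, where \<open>poly p t\<close>
  is a quotient of two positive exponential moments.\<close>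

lemma hermite_poly_nonneg:
  assumes "square_exp_law M" "hermite_fps M = fps_of_poly p"
  shows "0 \<le> poly p t"
proof -
  let ?\<gamma> = std_normal_distribution
  have "(\<lambda>k. fps_nth (mgf_fps M) k * t ^ k) sums (poly p t * (\<integral>x. exp (t * x) \<partial>?\<gamma>))"
    unfolding mgf_fps_eq_hermite[of M] assms(2)
    by (intro fps_of_poly_mult_sums mgf_fps_sums square_exp_law_std_normal)
  then have "poly p t * (\<integral>x. exp (t * x) \<partial>?\<gamma>) = (\<integral>x. exp (t * x) \<partial>M)"
    using mgf_fps_sums[OF assms(1)] sums_unique2 by blast
  then have "0 < poly p t * (\<integral>x. exp (t * x) \<partial>?\<gamma>)"
    using mgf_pos[OF assms(1), of t] by simp
  then show ?thesis
    using mgf_pos[OF square_exp_law_std_normal, of t] by (simp add: zero_less_mult_iff)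
qed

text \<open>Put F = G E in the moment equation: by E' = t E the terms t^2 G E cancel, and dividing
  by E leaves t times the derivative of G. Here \<open>c\<close> is the jump rate and
  \<open>M'\<close> the law at the left neighbour.\<close>

lemma hermite_fps_step:
  assumes "square_exp_law M" "square_exp_law M'"
    and rel: "\<And>k. c * ((\<integral>x. x ^ k \<partial>M') - (\<integral>x. x ^ k \<partial>M)) = (\<integral>x. OU (\<lambda>x. x ^ k) x \<partial>M)"
  shows "real k * fps_nth (hermite_fps M) k =
           c * (fps_nth (hermite_fps M) k - fps_nth (hermite_fps M') k)"
proof -
  let ?E = "mgf_fps std_normal_distribution"
  let ?G = "hermite_fps M" and ?G' = "hermite_fps M'"
  have "fps_const c * (mgf_fps M' - mgf_fps M) =
      fps_X * (fps_X * mgf_fps M - fps_deriv (mgf_fps M))"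
  proof (rule fps_ext)
    fix k
    have "fps_nth (fps_const c * (mgf_fps M' - mgf_fps M)) k =
        c * ((\<integral>x. x ^ k \<partial>M') - (\<integral>x. x ^ k \<partial>M)) / fact k"
      by (simp add: mgf_fps_def diff_divide_distrib right_diff_distrib)
    then show "fps_nth (fps_const c * (mgf_fps M' - mgf_fps M)) k =
        fps_nth (fps_X * (fps_X * mgf_fps M - fps_deriv (mgf_fps M))) k"
      by (simp only: rel mgf_fps_OU[OF assms(1)])
  qed
  then have "(fps_X * fps_deriv ?G) * ?E = (fps_const c * (?G - ?G')) * ?E"
    unfolding mgf_fps_eq_hermite[of M] mgf_fps_eq_hermite[of M']
    by (simp add: fps_deriv_mgf_std_normal algebra_simps)
  moreover have "?E \<noteq> 0"
    using mgf_fps_nth_0[OF square_exp_law_std_normal] by auto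
  ultimately have "fps_X * fps_deriv ?G = fps_const c * (?G - ?G')" by simp
  then have "fps_nth (fps_X * fps_deriv ?G) k = c * (fps_nth ?G k - fps_nth ?G' k)"
    by simp
  then show ?thesis by (cases k) simp_all
qed

subsection \<open>Intertwining kernels\<close>

lemma kernel_law:
  assumes "\<Lambda> \<in> yule_kernels N" "y \<in> {- int N..0}"
  shows "square_exp_law (\<Lambda> y)"
  using assms by (auto simp: yule_kernels_def square_exp_law_def)

text \<open>No jump leaves the leftmost state: rate 0 in \<open>hermite_fps_step\<close> kills every
  coefficient of positive index.\<close>

lemma kernel_hermite_left:
  assumes "\<Lambda> \<in> yule_kernels N" "intertwines N \<Lambda>"
  shows "hermite_fps (\<Lambda> (- int N)) = 1"
proof -
  have law: "square_exp_law (\<Lambda> (- int N))" by (rule kernel_law[OF assms(1)]) simp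
  have "0 * ((\<integral>x. x ^ k \<partial>\<Lambda> (- int N)) - (\<integral>x. x ^ k \<partial>\<Lambda> (- int N))) =
      (\<integral>x. OU (\<lambda>x. x ^ k) x \<partial>\<Lambda> (- int N))" for k
  proof -
    have "(\<lambda>x::real. x ^ k) = poly (monom 1 k)" by (simp add: fun_eq_iff poly_monom)
    then have "(\<lambda>x::real. x ^ k) \<in> poly_funs" by (auto simp: poly_funs_def)
    then show ?thesis using assms(2) by (force simp: intertwines_def rev_yule_def kernel_app_def)
  qed
  from hermite_fps_step[OF law law this]
  have "real k * fps_nth (hermite_fps (\<Lambda> (- int N))) k = 0" for k by simp
  then have "fps_nth (hermite_fps (\<Lambda> (- int N))) k = 0" if "k \<noteq> 0" for k
    using that by (metis mult_eq_0_iff of_nat_eq_0_iff)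
  then show ?thesis using hermite_fps_nth_0[OF law] by (simp add: fps_eq_iff)
qed

text \<open>At the state y = 1 - n the jump rate 1 - y is n and the left neighbour is -n.\<close>

lemma kernel_hermite_step:
  assumes "\<Lambda> \<in> yule_kernels N" "intertwines N \<Lambda>" "n \<ge> 1" "n \<le> N"
  shows "real k * fps_nth (hermite_fps (\<Lambda> (1 - int n))) k =
     real n * (fps_nth (hermite_fps (\<Lambda> (1 - int n))) k - fps_nth (hermite_fps (\<Lambda> (- int n))) k)"
proof (rule hermite_fps_step)
  show "square_exp_law (\<Lambda> (1 - int n))" "square_exp_law (\<Lambda> (- int n))"
    using assms by (auto intro!: kernel_law[OF assms(1)])
  fix k
  have "(\<lambda>x::real. x ^ k) = poly (monom 1 k)" by (simp add: fun_eq_iff poly_monom)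
  then have "(\<lambda>x::real. x ^ k) \<in> poly_funs" by (auto simp: poly_funs_def)
  moreover have "1 - int n \<in> {- int N..0}" "1 - int n \<in> {- int N + 1..0}" using assms by auto
  ultimately have "rev_yule N (kernel_app \<Lambda> (\<lambda>x. x ^ k)) (1 - int n) =
      kernel_app \<Lambda> (OU (\<lambda>x. x ^ k)) (1 - int n)"
    using assms(2) by (auto simp: intertwines_def)
  then show "real n * ((\<integral>x. x ^ k \<partial>\<Lambda> (- int n)) - (\<integral>x. x ^ k \<partial>\<Lambda> (1 - int n))) =
      (\<integral>x. OU (\<lambda>x. x ^ k) x \<partial>\<Lambda> (1 - int n))"
    using \<open>1 - int n \<in> {- int N + 1..0}\<close> by (simp add: rev_yule_def kernel_app_def)
qed

section \<open>Propagation of triviality from left to right\<close>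

lemma lead_coeff_nonneg:
  fixes p :: "real poly"
  assumes "\<And>t. 0 \<le> poly p t"
  shows "0 \<le> lead_coeff p"
proof (rule ccontr)
  assume "\<not> 0 \<le> lead_coeff p"
  then have pos: "lead_coeff (- p) > 0" by simp
  then obtain t where "poly (- p) t \<ge> lead_coeff (- p)"
    using poly_pinfty_gt_lc by blast
  then show False using pos assms[of t] by simp
qed

text \<open>For n \<ge> 2 the state 2 - n to the right still exists and supplies the second sign
  condition; at state 0, where n = 1, an affine function of t must be nonnegative on the whole
  line.\<close>

lemma kernel_hermite_step_trivial:
  assumes \<Lambda>: "\<Lambda> \<in> yule_kernels N" "intertwines N \<Lambda>" and n: "n \<ge> 1" "n \<le> N"
    and prev: "hermite_fps (\<Lambda> (- int n)) = 1"
  shows "hermite_fps (\<Lambda> (1 - int n)) = 1"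
proof -
  let ?G = "hermite_fps (\<Lambda> (1 - int n))"
  define c where "c = fps_nth ?G n"
  have law: "square_exp_law (\<Lambda> (1 - int n))"
    using n by (intro kernel_law[OF \<Lambda>(1)]) auto
  \<comment> \<open>The recursion becomes (k - n) g_k = 0 for k > 0, so only the resonant index k =
    n stays free.\<close>
  have "fps_nth ?G k = 0" if "k \<noteq> 0" "k \<noteq> n" for k
  proof -
    have "(real k - real n) * fps_nth ?G k = 0"
      using kernel_hermite_step[OF \<Lambda> n, of k] that by (simp add: prev algebra_simps)
    then show ?thesis using that by simp
  qed
  then have G: "?G = fps_of_poly (1 + monom c n)"
    using n hermite_fps_nth_0[OF law] by (auto simp: fps_eq_iff c_def)
  have nonneg: "0 \<le> poly (1 + monom c n) t" for t by (rule hermite_poly_nonneg[OF law G])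
  have "c = 0"
  proof (rule ccontr)
    assume c: "c \<noteq> 0"
    show False
    proof (cases "n = 1")
      case True
      \<comment> \<open>At this point 1 + c t equals -1.\<close>
      then show False using nonneg[of "- 2 / c"] c by (simp add: poly_monom)
    next
      case False
      then have n2: "n \<ge> 2" using n by simp
      have deg: "degree (1 + monom c n) = n"
        using n2 c by (subst degree_add_eq_right) (auto simp: degree_monom_eq)
      have "0 \<le> lead_coeff (1 + monom c n)"
        by (intro lead_coeff_nonneg nonneg)
      then have c0: "0 < c" using n c unfolding deg by simp
      text \<open>One state further to the right, the coefficient of index \<open>n\<close> is multiplied by the
        negative number \<open>- (n - 1)\<close>, while still being the leading one.\<close>
      let ?H = "hermite_fps (\<Lambda> (1 - int (n - 1)))"
      define b where "b = fps_nth ?H (n - 1)"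
      have n1: "n - 1 \<ge> 1" "n - 1 \<le> N" using n n2 by auto
      have eq: "- int (n - 1) = 1 - int n" using n by simp
      have law': "square_exp_law (\<Lambda> (1 - int (n - 1)))"
        using n1 by (intro kernel_law[OF \<Lambda>(1)]) auto
      \<comment> \<open>The factor on the left is 1 at k = n, which fixes that coefficient, and 0 at
        k = n - 1, which leaves \<open>b\<close> free.\<close>
      have step: "(real k - real (n - 1)) * fps_nth ?H k = - real (n - 1) * fps_nth ?G k" for k
        using kernel_hermite_step[OF \<Lambda> n1, of k] unfolding eq by (simp add: algebra_simps)
      let ?q = "1 + monom b (n - 1) + monom (- real (n - 1) * c) n"
      have H: "?H = fps_of_poly ?q"
      proof (rule fps_ext)
        fix k
        consider "k = 0" | "k = n - 1" | "k = n" | "k \<noteq> 0" "k \<noteq> n - 1" "k \<noteq> n" by blast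
        then show "fps_nth ?H k = fps_nth (fps_of_poly ?q) k"
        proof cases
          case 1
          then show ?thesis using n2 hermite_fps_nth_0[OF law'] by simp
        next
          case 2
          then show ?thesis using n2 by (simp add: b_def)
        next
          case 3
          have "fps_nth ?H n = - real (n - 1) * c"
            using step[of n] n by (simp add: c_def)
          then show ?thesis using n2 3 by simp
        next
          case 4
          have "fps_nth ?G k = 0" unfolding G using 4 by simp
          then have "(real k - real (n - 1)) * fps_nth ?H k = 0" using step[of k] by simp
          then show ?thesis using 4 by auto
        qed
      qed
      have "degree (1 + monom b (n - 1)) < n"
        using n2 degree_monom_le[of b "n - 1"] by (intro degree_add_less) auto
      then have deg': "degree ?q = n"
        using n2 c by (subst degree_add_eq_right) (auto simp: degree_monom_eq)
      have "0 \<le> lead_coeff ?q"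
        by (intro lead_coeff_nonneg hermite_poly_nonneg[OF law' H])
      moreover have "n - 1 \<noteq> n" using n2 by simp
      ultimately have "0 \<le> - real (n - 1) * c" using n2 unfolding deg' by simp
      then show False using c0 n1(1) by (simp add: mult_le_0_iff del: of_nat_diff)
    qed
  qed
  then show ?thesis by (simp add: G)
qed

lemma kernel_eq_std_normal:
  assumes \<Lambda>: "\<Lambda> \<in> yule_kernels N" "intertwines N \<Lambda>" and y: "y \<in> {- int N..0}"
  shows "\<Lambda> y = std_normal_distribution"
proof -
  have "hermite_fps (\<Lambda> (- int n)) = 1" if "n \<le> N" for n
    using that
  \<comment> \<open>Descending from n = N to 0 moves the state -n rightwards from the left
    end.\<close>
  proof (induction rule: inc_induct)
    case base
    show ?case by (rule kernel_hermite_left[OF \<Lambda>])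
  next
    case (step n)
    then show ?case using kernel_hermite_step_trivial[OF \<Lambda>, of "Suc n"] by simp
  qed
  from this[of "nat (- y)"] have "hermite_fps (\<Lambda> y) = 1" using y by (simp add: nat_le_iff)
  then show ?thesis by (rule hermite_fps_eq_1[OF kernel_law[OF \<Lambda>(1) y]])
qed

section \<open>Existence and uniqueness\<close>

lemma std_normal_kernel:
  defines "\<Lambda> N \<equiv> restrict (\<lambda>_. std_normal_distribution) {- int N..0}"
  shows "\<Lambda> N \<in> yule_kernels N" "intertwines N (\<Lambda> N)"
proof -
  show "\<Lambda> N \<in> yule_kernels N"
    using square_exp_law_std_normal
    by (auto simp: \<Lambda>_def yule_kernels_def square_exp_law_def)
  \<comment> \<open>Both sides vanish: the left one as a difference of equal integrals, the right
    one by invariance.\<close>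
  show "intertwines N (\<Lambda> N)"
    unfolding intertwines_def poly_funs_def
    by (auto simp: \<Lambda>_def rev_yule_def kernel_app_def integral_OU_std_normal)
qed

theorem mainTheorem9:
  fixes N :: nat
  assumes "N \<ge> 1"
  shows "(\<exists>!\<Lambda>. \<Lambda> \<in> yule_kernels N \<and> intertwines N \<Lambda>) \<and>
         (\<forall>\<Lambda>. \<Lambda> \<in> yule_kernels N \<and> intertwines N \<Lambda> \<longrightarrow>
            (\<forall>y\<in>{- int N..0}. \<forall>z\<in>{- int N..0}. \<Lambda> y = \<Lambda> z))"
proof (intro conjI allI impI ballI)
  show "\<exists>!\<Lambda>. \<Lambda> \<in> yule_kernels N \<and> intertwines N \<Lambda>"
  proof (rule ex_ex1I)
    show "\<exists>\<Lambda>. \<Lambda> \<in> yule_kernels N \<and> intertwines N \<Lambda>"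
      using std_normal_kernel by blast
    fix \<Lambda> \<Lambda>'
    assume asm: "\<Lambda> \<in> yule_kernels N \<and> intertwines N \<Lambda>" "\<Lambda>' \<in> yule_kernels N \<and> intertwines N \<Lambda>'"
    then have eq: "\<Lambda> y = \<Lambda>' y" if "y \<in> {- int N..0}" for y
      using kernel_eq_std_normal[OF _ _ that] by metis
    show "\<Lambda> = \<Lambda>'"
    proof (rule PiE_ext)
      show "\<Lambda> \<in> {- int N..0} \<rightarrow>\<^sub>E space (prob_algebra borel)"
        "\<Lambda>' \<in> {- int N..0} \<rightarrow>\<^sub>E space (prob_algebra borel)"
        using asm by (simp_all add: yule_kernels_def)
    qed (rule eq)
  qed
next
  fix \<Lambda> y z
  assume "\<Lambda> \<in> yule_kernels N \<and> intertwines N \<Lambda>" "y \<in> {- int N..0}" "z \<in> {- int N..0}"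
  then show "\<Lambda> y = \<Lambda> z" using kernel_eq_std_normal by metis
qed

end
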